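(* Any rotational hypersurface $(M,\bar g,J)$ of type II in $\mathbb C^n\times\mathbb R$ ($\dim M=2n\ge4$, with $t(s)>0$, $t'(s)\ge1$ for $s\in I$), whose Kähler metric $$g=\bar g+(t'-1)(\bar\eta\otimes\bar\eta+\tilde{\bar\eta}\otimes\tilde{\bar\eta})$$ is of constant holomorphic sectional curvatures $a=\mathrm{const}<0$, is generated by a meridian of the type $$\gamma:\ q=\pm\frac1{\sqrt{-a}}\left(\sqrt{8-at^2}+\ln\frac{\sqrt{8-at^2}-2}{\sqrt{8-at^2}+2}\right)+q_0,\qquad t>0,$$ in the hyperbolic plane $O\mathbf{ne}$, where $q_0$ is a constant.
   Context: Rotational hypersurfaces of type II: let $(\mathbb C^n,g',J_0)$ be the complex Euclidean space with standard complex structure $J_0$, and let $\mathbb R$ be spanned by $\mathbf e$ with $\mathbf e^2=-1$; the product metric on $\mathbb C^n\times\mathbb R$ has signature $(2n,1)$. For smooth functions $t(s)>0$, $q(s)$ on an interval $I$, the rotational hypersurface $M$ consists of the points $\mathbf Z=t(s)\mathbf n+q(s)\mathbf e$, $s\in I$, $\mathbf n\in S^{2n-1}(1)\subset\mathbb C^n$; its meridian is $\gamma:\mathbf z(s)=t(s)\mathbf n+q(s)\mathbf e$ ($\mathbf n$ fixed), a curve in the plane $O\mathbf{ne}$ spanned by $\mathbf n,\mathbf e$ (with indefinite metric), which can be written as $q=q(t)$. $M$ is of type II if its normals are time-like; $s$ is a natural parameter, $t'^2-q'^2=1$, and the meridians are oriented so that $t'\ge1$. Structures on $M$: $\bar g$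 is the induced metric; $\bar\xi=\partial\mathbf Z/\partial s$; $\tilde{\bar\xi}=J_0\mathbf n$; $\bar\eta=\bar g(\bar\xi,\cdot)$, $\tilde{\bar\eta}=\bar g(\tilde{\bar\xi},\cdot)$; $D$ is the $\bar g$-orthogonal complement of $\mathrm{span}\{\bar\xi,\tilde{\bar\xi}\}$ in $TM$; $J|_D=J_0$, $J\bar\xi=\tilde{\bar\xi}$, $J\tilde{\bar\xi}=-\bar\xi$. The metric $g$ is Kähler with respect to $J$. *)

theory Defs
  imports "HOL-Analysis.Analysis"
begin

section \<open>Smooth maps and local parametrizations\<close>

text \<open>\<open>Ck_on k f S\<close> is meant for open \<open>S\<close> in a finite-dimensional space, where it is the usual
  \<open>k\<close>-fold continuous differentiability.\<close>

primrec Ck_on ::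
  "nat \<Rightarrow> ('a::real_normed_vector \<Rightarrow> 'b::real_normed_vector) \<Rightarrow> 'a set \<Rightarrow> bool" where
  "Ck_on 0 f S \<longleftrightarrow> continuous_on S f"
| "Ck_on (Suc k) f S \<longleftrightarrow>
     f differentiable_on S \<and> (\<forall>v. Ck_on k (\<lambda>x. frechet_derivative f (at x) v) S)"

definition smooth_on ::
  "('a::real_normed_vector \<Rightarrow> 'b::real_normed_vector) \<Rightarrow> 'a set \<Rightarrow> bool" where
  "smooth_on f S \<longleftrightarrow> (\<forall>k. Ck_on k f S)"

definition tangent_space :: "'b::real_normed_vector set \<Rightarrow> 'b \<Rightarrow> 'b set" where
  "tangent_space M Z =
     {X. \<exists>c e. e > 0 \<and> smooth_on c {-e<..<e} \<and> c ` {-e<..<e} \<subseteq> M \<and> c 0 = Z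
              \<and> (c has_vector_derivative X) (at (0::real))}"

text \<open>When the dimension of \<open>'a\<close> equals that of the embedded submanifold \<open>M\<close>, these are the inverses
  of the charts of \<open>M\<close>.\<close>

definition local_parametrization ::
  "('a::euclidean_space \<Rightarrow> 'b::euclidean_space) \<Rightarrow> 'a set \<Rightarrow> 'b set \<Rightarrow> bool" where
  "local_parametrization F U M \<longleftrightarrow>
     open U \<and> smooth_on F U \<and> F ` U \<subseteq> M \<and> openin (top_of_set M) (F ` U)
     \<and> (\<exists>G. homeomorphism U (F ` U) F G)
     \<and> (\<forall>x\<in>U. inj (frechet_derivative F (at x)))"

section \<open>Sectional curvature in coordinates\<close>

text \<open>A metric on an open subset of \<open>'a\<close> is a field \<open>h\<close> of bilinear forms. Its Levi-Civita
  connection is \<open>\<nabla>\<^sub>u V = \<partial>\<^sub>u V + \<Gamma>(u, V)\<close>, where \<open>\<Gamma>\<close> is determined by the Koszul formula for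
  constant vector fields.\<close>

definition christoffel ::
  "('a::euclidean_space \<Rightarrow> 'a \<Rightarrow> 'a \<Rightarrow> real) \<Rightarrow> 'a \<Rightarrow> 'a \<Rightarrow> 'a \<Rightarrow> 'a" where
  "christoffel h x u v = (THE G. \<forall>w. 2 * h x G w =
       frechet_derivative (\<lambda>y. h y v w) (at x) u
     + frechet_derivative (\<lambda>y. h y u w) (at x) v
     - frechet_derivative (\<lambda>y. h y u v) (at x) w)"

text \<open>\<open>riemann h x u v w\<close> is \<open>R(u,v)w = \<nabla>\<^sub>u \<nabla>\<^sub>v w - \<nabla>\<^sub>v \<nabla>\<^sub>u w\<close> for constant fields \<open>u\<close>, \<open>v\<close>, \<open>w\<close>.\<close>

definition riemann ::
  "('a::euclidean_space \<Rightarrow> 'a \<Rightarrow> 'a \<Rightarrow> real) \<Rightarrow> 'a \<Rightarrow> 'a \<Rightarrow> 'a \<Rightarrow> 'a \<Rightarrow> 'a" where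
  "riemann h x u v w =
       frechet_derivative (\<lambda>y. christoffel h y v w) (at x) u
     - frechet_derivative (\<lambda>y. christoffel h y u w) (at x) v
     + christoffel h x u (christoffel h x v w)
     - christoffel h x v (christoffel h x u w)"

definition sectional_curvature ::
  "('a::euclidean_space \<Rightarrow> 'a \<Rightarrow> 'a \<Rightarrow> real) \<Rightarrow> 'a \<Rightarrow> 'a \<Rightarrow> 'a \<Rightarrow> real" where
  "sectional_curvature h x u v =
     h x (riemann h x u v v) u / (h x u u * h x v v - (h x u v)\<^sup>2)"

definition pullback ::
  "('a::euclidean_space \<Rightarrow> 'b::euclidean_space) \<Rightarrow> ('b \<Rightarrow> 'b \<Rightarrow> 'b \<Rightarrow> real)
    \<Rightarrow> 'a \<Rightarrow> 'a \<Rightarrow> 'a \<Rightarrow> real" where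
  "pullback F g x u v =
     g (F x) (frechet_derivative F (at x) u) (frechet_derivative F (at x) v)"

section \<open>Rotational hypersurfaces in \<open>\<complex>\<^sup>n \<times> \<real>\<close>\<close>

text \<open>The point \<open>z + r e\<close> of the ambient space is the pair \<open>(z, r)\<close>. The real part of the Hermitian
  product on \<open>\<complex>\<^sup>n\<close> is the library's \<open>inner\<close>, and \<open>e\<^sup>2 = -1\<close>.\<close>

type_synonym 'n ambient = "(complex ^ 'n) \<times> real"

definition mink :: "'n::finite ambient \<Rightarrow> 'n ambient \<Rightarrow> real" where
  "mink X Y = fst X \<bullet> fst Y - snd X * snd Y"

definition J0 :: "complex ^ 'n::finite \<Rightarrow> complex ^ 'n" where
  "J0 v = \<i> *s v"

definition rot_point ::
  "(real \<Rightarrow> real) \<Rightarrow> (real \<Rightarrow> real) \<Rightarrow> real \<Rightarrow> complex ^ 'n::finite \<Rightarrow> 'n ambient" where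
  "rot_point t q s n = (t s *\<^sub>R n, q s)"

definition rot_hypersurface ::
  "real set \<Rightarrow> (real \<Rightarrow> real) \<Rightarrow> (real \<Rightarrow> real) \<Rightarrow> 'n::finite ambient set" where
  "rot_hypersurface I t q = {rot_point t q s n | s n. s \<in> I \<and> norm n = 1}"

text \<open>Time-likeness of the normals does not depend on the choice of normal vector, so it is
  required for all of them. The interval is open, so that the hypersurface has no boundary.\<close>

definition type_II_hypersurface ::
  "'n::finite itself \<Rightarrow> real set \<Rightarrow> (real \<Rightarrow> real) \<Rightarrow> (real \<Rightarrow> real) \<Rightarrow> bool" where
  "type_II_hypersurface _ I t q \<longleftrightarrow>
     open I \<and> is_interval I \<and> smooth_on t I \<and> smooth_on q I
     \<and> (\<forall>s\<in>I. t s > 0)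
     \<and> (\<forall>Z \<in> (rot_hypersurface I t q :: 'n ambient set). \<forall>N. N \<noteq> 0 \<longrightarrow>
          (\<forall>X \<in> tangent_space (rot_hypersurface I t q) Z. mink N X = 0) \<longrightarrow> mink N N < 0)
     \<and> (\<forall>s\<in>I. (deriv t s)\<^sup>2 - (deriv q s)\<^sup>2 = 1)
     \<and> (\<forall>s\<in>I. deriv t s \<ge> 1)"

text \<open>The pair \<open>(s, n)\<close> with \<open>Z = t(s) n + q(s) e\<close>.\<close>

definition rot_coords ::
  "real set \<Rightarrow> (real \<Rightarrow> real) \<Rightarrow> (real \<Rightarrow> real) \<Rightarrow> 'n::finite ambient
    \<Rightarrow> real \<times> (complex ^ 'n)" where
  "rot_coords I t q Z = the_inv_into (I \<times> sphere 0 1) (\<lambda>(s, n). rot_point t q s n) Z"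

definition xi ::
  "real set \<Rightarrow> (real \<Rightarrow> real) \<Rightarrow> (real \<Rightarrow> real) \<Rightarrow> 'n::finite ambient \<Rightarrow> 'n ambient" where
  "xi I t q Z = (case rot_coords I t q Z of (s, n) \<Rightarrow>
     vector_derivative (\<lambda>\<sigma>. rot_point t q \<sigma> n) (at s))"

definition xi_tilde ::
  "real set \<Rightarrow> (real \<Rightarrow> real) \<Rightarrow> (real \<Rightarrow> real) \<Rightarrow> 'n::finite ambient \<Rightarrow> 'n ambient" where
  "xi_tilde I t q Z = (J0 (snd (rot_coords I t q Z)), 0)"

definition eta ::
  "real set \<Rightarrow> (real \<Rightarrow> real) \<Rightarrow> (real \<Rightarrow> real) \<Rightarrow> 'n::finite ambient \<Rightarrow> 'n ambient \<Rightarrow> real" where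
  "eta I t q Z X = mink (xi I t q Z) X"

definition eta_tilde ::
  "real set \<Rightarrow> (real \<Rightarrow> real) \<Rightarrow> (real \<Rightarrow> real) \<Rightarrow> 'n::finite ambient \<Rightarrow> 'n ambient \<Rightarrow> real" where
  "eta_tilde I t q Z X = mink (xi_tilde I t q Z) X"

definition distr_D ::
  "real set \<Rightarrow> (real \<Rightarrow> real) \<Rightarrow> (real \<Rightarrow> real) \<Rightarrow> 'n::finite ambient \<Rightarrow> 'n ambient set" where
  "distr_D I t q Z = {X \<in> tangent_space (rot_hypersurface I t q) Z.
     mink (xi I t q Z) X = 0 \<and> mink (xi_tilde I t q Z) X = 0}"

text \<open>The tensors below are written for arbitrary ambient vectors but matter only on tangent
  vectors. For tangent \<open>X\<close>, \<open>Y\<close> is the component of \<open>X\<close> in \<open>distr_D\<close>, whose elements have zero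
  \<open>e\<close>-component. The lemmas \<open>Jstruct_xi\<close>, \<open>Jstruct_xi_tilde\<close> and \<open>Jstruct_D\<close> below verify the
  properties that characterize \<open>J\<close>.\<close>

definition Jstruct ::
  "real set \<Rightarrow> (real \<Rightarrow> real) \<Rightarrow> (real \<Rightarrow> real) \<Rightarrow> 'n::finite ambient \<Rightarrow> 'n ambient \<Rightarrow> 'n ambient"
  where
  "Jstruct I t q Z X =
     (let Y = X - eta I t q Z X *\<^sub>R xi I t q Z - eta_tilde I t q Z X *\<^sub>R xi_tilde I t q Z
      in eta I t q Z X *\<^sub>R xi_tilde I t q Z - eta_tilde I t q Z X *\<^sub>R xi I t q Z + (J0 (fst Y), 0))"

definition kahler_metric ::
  "real set \<Rightarrow> (real \<Rightarrow> real) \<Rightarrow> (real \<Rightarrow> real) \<Rightarrow> 'n::finite ambient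
    \<Rightarrow> 'n ambient \<Rightarrow> 'n ambient \<Rightarrow> real" where
  "kahler_metric I t q Z X Y = mink X Y
     + (deriv t (fst (rot_coords I t q Z)) - 1)
       * (eta I t q Z X * eta I t q Z Y + eta_tilde I t q Z X * eta_tilde I t q Z Y)"

text \<open>Sectional curvature of every plane spanned by \<open>X\<close> and \<open>J X\<close>, computed in every local
  parametrization. The real vector space \<open>\<complex>\<^sup>n\<close> serves as the parameter space \<open>\<real>\<^bsup>2n\<^esup>\<close>.\<close>

definition constant_holomorphic_curvature ::
  "'n::finite ambient set \<Rightarrow> ('n ambient \<Rightarrow> 'n ambient \<Rightarrow> 'n ambient \<Rightarrow> real)
    \<Rightarrow> ('n ambient \<Rightarrow> 'n ambient \<Rightarrow> 'n ambient) \<Rightarrow> real \<Rightarrow> bool" where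
  "constant_holomorphic_curvature M g J a \<longleftrightarrow>
     (\<forall>(F :: complex ^ 'n \<Rightarrow> 'n ambient) U. local_parametrization F U M \<longrightarrow>
        (\<forall>x\<in>U. \<forall>u w. u \<noteq> 0 \<longrightarrow>
           frechet_derivative F (at x) w = J (F x) (frechet_derivative F (at x) u) \<longrightarrow>
           sectional_curvature (pullback F g) x u w = a))"

lemma J0_orthogonal: "J0 n \<bullet> n = 0"
  unfolding J0_def inner_vec_def by (simp add: inner_complex_def)

lemma J0_norm: "J0 n \<bullet> J0 n = n \<bullet> n"
  unfolding J0_def inner_vec_def by (simp add: inner_complex_def add.commute)

lemma J0_zero: "J0 0 = 0"
  by (simp add: J0_def)

lemma Pair_zero: "(0, 0) = 0"
  by (simp add: zero_prod_def)

lemma type_II_derivs: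
  assumes "type_II_hypersurface TYPE('n::finite) I t q" "s \<in> I"
  shows "(t has_real_derivative deriv t s) (at s)" "(q has_real_derivative deriv q s) (at s)"
proof -
  have "smooth_on t I" "smooth_on q I" and o: "open I"
    using assms(1) by (auto simp: type_II_hypersurface_def)
  then have "Ck_on (Suc 0) t I" "Ck_on (Suc 0) q I" unfolding smooth_on_def by blast+
  then have "t differentiable_on I" "q differentiable_on I" by (simp_all only: Ck_on.simps)
  then have "t differentiable (at s)" "q differentiable (at s)"
    using o assms(2) differentiable_on_eq_differentiable_at by blast+
  then show "(t has_real_derivative deriv t s) (at s)" "(q has_real_derivative deriv q s) (at s)"
    by (simp_all only: DERIV_deriv_iff_real_differentiable)
qed

lemma type_II_inj:
  assumes "type_II_hypersurface TYPE('n::finite) I t q"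
  shows "inj_on t I"
proof -
  have interval: "is_interval I"
    using assms by (simp add: type_II_hypersurface_def)
  have less: "t u < t v" if uv: "u \<in> I" "v \<in> I" "u < v" for u v
  proof (rule DERIV_pos_imp_increasing[OF \<open>u < v\<close>])
    fix x assume "u \<le> x" "x \<le> v"
    then have x: "x \<in> I"
      using interval uv by (meson mem_is_interval_1_I)
    then have "deriv t x > 0"
      using assms by (force simp: type_II_hypersurface_def)
    then show "\<exists>y. (t has_real_derivative y) (at x) \<and> 0 < y"
      using type_II_derivs(1)[OF assms x] by blast
  qed
  show ?thesis
  proof (rule inj_onI)
    fix x y assume "x \<in> I" "y \<in> I" "t x = t y"
    then show "x = y" using less[of x y] less[of y x] by (cases x y rule: linorder_cases) auto
  qed
qed

lemma rot_coords_point: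
  fixes n :: "complex ^ 'n::finite"
  assumes T: "type_II_hypersurface TYPE('n) I t q" and "s \<in> I" "norm n = 1"
  shows "rot_coords I t q (rot_point t q s n) = (s, n)"
proof -
  have pos: "t s > 0" if "s \<in> I" for s
    using T that by (auto simp: type_II_hypersurface_def)
  have "inj_on (\<lambda>(s, n :: complex ^ 'n). rot_point t q s n) (I \<times> sphere 0 1)"
  proof (rule inj_onI, clarsimp simp: rot_point_def)
    fix s s' and m m' :: "complex ^ 'n"
    assume a: "s \<in> I" "s' \<in> I" "norm m = 1" "norm m' = 1" "t s *\<^sub>R m = t s' *\<^sub>R m'"
    have "norm (t s *\<^sub>R m) = t s" "norm (t s' *\<^sub>R m') = t s'"
      using a(1-4) pos[of s] pos[of s'] by auto
    then have "t s = t s'" using a(5) by metis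
    then show "s = s' \<and> m = m'"
      using a pos[of s'] inj_onD[OF type_II_inj[OF T]] by auto
  qed
  from the_inv_into_f_f[OF this, of "(s, n)"] show ?thesis
    using assms by (simp add: rot_coords_def)
qed

lemma xi_point:
  fixes n :: "complex ^ 'n::finite"
  assumes "type_II_hypersurface TYPE('n) I t q" "s \<in> I" "norm n = 1"
  shows "xi I t q (rot_point t q s n) = (deriv t s *\<^sub>R n, deriv q s)"
proof -
  have "(t has_vector_derivative deriv t s) (at s)" "(q has_vector_derivative deriv q s) (at s)"
    using type_II_derivs[OF assms(1,2)]
    by (simp_all add: has_real_derivative_iff_has_vector_derivative)
  then have "((\<lambda>\<sigma>. (t \<sigma> *\<^sub>R n, q \<sigma>)) has_vector_derivative (deriv t s *\<^sub>R n, deriv q s)) (at s)"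
    by (intro has_vector_derivative_Pair
        bounded_linear.has_vector_derivative[OF bounded_linear_scaleR_left])
  then show ?thesis
    unfolding xi_def rot_coords_point[OF assms] prod.case
    unfolding rot_point_def by (rule vector_derivative_at)
qed

lemma xi_frame:
  fixes Z :: "'n::finite ambient"
  assumes T: "type_II_hypersurface TYPE('n) I t q" and Z: "Z \<in> rot_hypersurface I t q"
  shows "mink (xi I t q Z) (xi I t q Z) = 1"
    and "mink (xi_tilde I t q Z) (xi_tilde I t q Z) = 1"
    and "mink (xi I t q Z) (xi_tilde I t q Z) = 0"
    and "mink (xi_tilde I t q Z) (xi I t q Z) = 0"
proof -
  obtain s n where sn: "Z = rot_point t q s n" "s \<in> I" "norm n = 1"
    using Z by (auto simp: rot_hypersurface_def)
  have nn: "n \<bullet> n = 1" using sn by (simp add: dot_square_norm)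
  have d: "(deriv t s)\<^sup>2 - (deriv q s)\<^sup>2 = 1" using T sn by (auto simp: type_II_hypersurface_def)
  have x: "xi I t q Z = (deriv t s *\<^sub>R n, deriv q s)" using xi_point[OF T] sn by simp
  have y: "xi_tilde I t q Z = (J0 n, 0)"
    using rot_coords_point[OF T] sn by (simp add: xi_tilde_def)
  show "mink (xi I t q Z) (xi I t q Z) = 1"
    "mink (xi_tilde I t q Z) (xi_tilde I t q Z) = 1"
    "mink (xi I t q Z) (xi_tilde I t q Z) = 0"
    "mink (xi_tilde I t q Z) (xi I t q Z) = 0"
    unfolding x y using d nn J0_norm[of n] J0_orthogonal[of n] inner_commute[of n "J0 n"]
    by (simp_all add: mink_def power2_eq_square)
qed

lemma Jstruct_xi:
  fixes Z :: "'n::finite ambient"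
  assumes "type_II_hypersurface TYPE('n) I t q" "Z \<in> rot_hypersurface I t q"
  shows "Jstruct I t q Z (xi I t q Z) = xi_tilde I t q Z"
  using xi_frame[OF assms]
  by (simp add: Jstruct_def eta_def eta_tilde_def J0_zero Pair_zero)

lemma Jstruct_xi_tilde:
  fixes Z :: "'n::finite ambient"
  assumes "type_II_hypersurface TYPE('n) I t q" "Z \<in> rot_hypersurface I t q"
  shows "Jstruct I t q Z (xi_tilde I t q Z) = - xi I t q Z"
  using xi_frame[OF assms]
  by (simp add: Jstruct_def eta_def eta_tilde_def J0_zero Pair_zero)

lemma Jstruct_D:
  assumes "X \<in> distr_D I t q Z"
  shows "Jstruct I t q Z X = (J0 (fst X), 0)"
  using assms by (simp add: Jstruct_def distr_D_def eta_def eta_tilde_def)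

end

theory Submission
  imports Defs
begin

text \<open>The hypersurface is the graph of a function of \<open>z \<bullet> z\<close>, and in this chart the metric is
  \<open>u \<bullet> v + A (z \<bullet> u) (z \<bullet> v) + B (J z \<bullet> u) (J z \<bullet> v)\<close> with functions \<open>A\<close>, \<open>B\<close> of \<open>z \<bullet> z\<close>, where
  \<open>B = (t' - 1) / t\<^sup>2\<close>. A holomorphic plane orthogonal to \<open>z\<close> and \<open>J z\<close> has curvature \<open>- 4 B\<close>; it
  exists because \<open>n \<ge> 2\<close>. Hence \<open>t' = 1 - a t\<^sup>2 / 4\<close> without solving any second-order equation,
  and \<open>q'\<^sup>2 = t'\<^sup>2 - 1\<close> has no zeros, so that \<open>q'\<close> has constant sign and integrates to the
  stated function.\<close>

section \<open>Calculus of smooth maps\<close>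

lemma Ck_on_SucD:
  assumes "Ck_on (Suc k) f S" "open S" "x \<in> S"
  shows "(f has_derivative frechet_derivative f (at x)) (at x)"
proof -
  have "f differentiable_on S" using assms(1) by simp
  then have "f differentiable (at x)"
    using differentiable_on_eq_differentiable_at[OF assms(2)] assms(3) by blast
  then show ?thesis by (simp only: frechet_derivative_works)
qed

text \<open>Openness of \<open>S\<close> lets equality on \<open>S\<close> pass to the derivatives,
  so the induction runs over both functions at once.\<close>

lemma Ck_on_cong:
  assumes "open S" "\<And>x. x \<in> S \<Longrightarrow> f x = g x" "Ck_on k f S"
  shows "Ck_on k g S"
  using assms(2,3)
proof (induction k arbitrary: f g)
  case 0
  then show ?case using continuous_on_cong[of S S f g] by simp
next
  case (Suc k)
  have d: "(g has_derivative frechet_derivative f (at x)) (at x)" if "x \<in> S" for x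
    using has_derivative_transform_within_open[OF Ck_on_SucD[OF Suc.prems(2) assms(1) that] assms(1) that]
      Suc.prems(1) by blast
  have "Ck_on k (\<lambda>x. frechet_derivative g (at x) v) S" for v
  proof (rule Suc.IH)
    show "Ck_on k (\<lambda>x. frechet_derivative f (at x) v) S" using Suc.prems(2) by simp
    show "frechet_derivative f (at x) v = frechet_derivative g (at x) v" if "x \<in> S" for x
      using frechet_derivative_at[OF d[OF that]] by simp
  qed
  moreover have "g differentiable_on S"
    using d by (auto simp: differentiable_on_def differentiable_def intro: has_derivative_at_withinI)
  ultimately show ?case by simp
qed

text \<open>Allows the derivative to be supplied as any convenient formula \<open>f'\<close>, so
  that each closure proof below needs only a differentiation rule and the regularity of its
  result.\<close>

lemma Ck_on_SucI:
  assumes "open S" and d: "\<And>x. x \<in> S \<Longrightarrow> (f has_derivative f' x) (at x)"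
    and "\<And>v. Ck_on k (\<lambda>x. f' x v) S"
  shows "Ck_on (Suc k) f S"
proof -
  have "f differentiable_on S"
    using d by (auto simp: differentiable_on_def differentiable_def intro: has_derivative_at_withinI)
  moreover have "Ck_on k (\<lambda>x. frechet_derivative f (at x) v) S" for v
  proof (rule Ck_on_cong[OF assms(1) _ assms(3)])
    show "f' x v = frechet_derivative f (at x) v" if "x \<in> S" for x
      using frechet_derivative_at[OF d[OF that]] by simp
  qed
  ultimately show ?thesis by simp
qed

lemma Ck_on_SucD_weak:
  assumes "open S" "Ck_on (Suc k) f S"
  shows "Ck_on k f S"
  using assms(2)
proof (induction k arbitrary: f)
  case 0
  then show ?case by (simp add: differentiable_imp_continuous_on)
qed simp

lemma Ck_on_const: "open S \<Longrightarrow> Ck_on k (\<lambda>x. c) S"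
proof (induction k arbitrary: c)
  case (Suc k)
  then show ?case by (intro Ck_on_SucI[where f' = "\<lambda>x v. 0"]) auto
qed simp

lemma Ck_on_linear:
  assumes "bounded_linear L" "open S"
  shows "Ck_on k L S"
proof (cases k)
  case 0
  then show ?thesis
    using assms by (simp add: linear_continuous_on)
next
  case (Suc m)
  then show ?thesis
    using assms by (auto intro!: Ck_on_SucI[where f' = "\<lambda>x. L"] Ck_on_const
        bounded_linear.has_derivative[OF _ has_derivative_ident] simp del: Ck_on.simps)
qed

lemma Ck_on_add:
  assumes "open S" "Ck_on k f S" "Ck_on k g S"
  shows "Ck_on k (\<lambda>x. f x + g x) S"
  using assms(2,3)
proof (induction k arbitrary: f g)
  case 0
  then show ?case by (simp add: continuous_on_add)
next
  case (Suc k)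
  note d = Ck_on_SucD[OF Suc.prems(1) assms(1)] Ck_on_SucD[OF Suc.prems(2) assms(1)]
  from Suc show ?case
    by (intro Ck_on_SucI[OF assms(1) has_derivative_add[OF d]]) auto
qed

text \<open>The product rule pairs each factor with a derivative of the other. The induction
  hypothesis covers both terms once the undifferentiated factor is weakened by one order.\<close>

lemma Ck_on_bilinear:
  assumes "bounded_bilinear b" "open S" "Ck_on k f S" "Ck_on k g S"
  shows "Ck_on k (\<lambda>x. b (f x) (g x)) S"
  using assms(3,4)
proof (induction k arbitrary: f g)
  case 0
  then show ?case by (simp add: bounded_bilinear.continuous_on[OF assms(1)])
next
  case (Suc k)
  note d = Ck_on_SucD[OF Suc.prems(1) assms(2)] Ck_on_SucD[OF Suc.prems(2) assms(2)]
  have "Ck_on k f S" "Ck_on k g S" using Suc.prems Ck_on_SucD_weak[OF assms(2)] by auto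
  with Suc show ?case
    by (intro Ck_on_SucI[OF assms(2) bounded_bilinear.FDERIV[OF assms(1) d]]
        Ck_on_add[OF assms(2)]) auto
qed

lemmas Ck_on_mult = Ck_on_bilinear[OF bounded_bilinear_mult]
lemmas Ck_on_inner = Ck_on_bilinear[OF bounded_bilinear_inner]

lemma Ck_on_Pair:
  assumes "open S" "Ck_on k f S" "Ck_on k g S"
  shows "Ck_on k (\<lambda>x. (f x, g x)) S"
  using assms(2,3)
proof (induction k arbitrary: f g)
  case 0
  then show ?case by (simp add: continuous_on_Pair)
next
  case (Suc k)
  note d = Ck_on_SucD[OF Suc.prems(1) assms(1)] Ck_on_SucD[OF Suc.prems(2) assms(1)]
  from Suc show ?case
    by (intro Ck_on_SucI[OF assms(1) has_derivative_Pair[OF d]]) auto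
qed

section \<open>Real functions: derivatives, composition and inverses\<close>

lemma smooth_on_DERIV:
  fixes f :: "real \<Rightarrow> real"
  assumes "smooth_on f S" "open S" "x \<in> S"
  shows "(f has_real_derivative deriv f x) (at x)"
proof -
  have "Ck_on (Suc 0) f S" using assms(1) by (simp add: smooth_on_def del: Ck_on.simps)
  then have "f differentiable (at x)"
    using Ck_on_SucD[OF _ assms(2,3)] by (metis differentiableI)
  then show ?thesis by (simp only: DERIV_deriv_iff_real_differentiable)
qed

lemma smooth_on_deriv:
  fixes f :: "real \<Rightarrow> real"
  assumes "smooth_on f S" "open S"
  shows "smooth_on (deriv f) S"
  unfolding smooth_on_def
proof
  fix k
  have c: "Ck_on (Suc k) f S" using assms(1) by (simp add: smooth_on_def del: Ck_on.simps)
  show "Ck_on k (deriv f) S"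
  proof (rule Ck_on_cong[OF assms(2)])
    \<comment> \<open>The ordinary derivative is the Frechet derivative in the direction 1.\<close>
    show "Ck_on k (\<lambda>x. frechet_derivative f (at x) 1) S" using c by simp
    show "frechet_derivative f (at x) 1 = deriv f x" if "x \<in> S" for x
      using frechet_derivative_at[OF smooth_on_DERIV[OF assms that, unfolded has_field_derivative_def]]
      by (metis mult.right_neutral)
  qed
qed

text \<open>Full smoothness of \<open>f\<close> makes the induction hypothesis applicable to
  \<open>deriv f\<close>, which the chain rule puts in place of \<open>f\<close>.\<close>

lemma Ck_on_compose_real:
  fixes f :: "real \<Rightarrow> real" and g :: "'a::real_normed_vector \<Rightarrow> real"
  assumes "open S" "open T" "g ` S \<subseteq> T" "smooth_on f T" "Ck_on k g S"
  shows "Ck_on k (\<lambda>x. f (g x)) S"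
  using assms(4,5)
proof (induction k arbitrary: f)
  case 0
  then have "Ck_on 0 f T" by (simp only: smooth_on_def)
  then show ?case
    using 0 assms(3) by (auto intro: continuous_on_compose2)
next
  case (Suc k)
  note d = Ck_on_SucD[OF Suc.prems(2) assms(1)]
  have c: "Ck_on k (\<lambda>x. deriv f (g x)) S"
    using Suc.IH[OF smooth_on_deriv[OF Suc.prems(1) assms(2)]] Suc.prems(2)
      Ck_on_SucD_weak[OF assms(1)] by blast
  show ?case
  proof (rule Ck_on_SucI[OF assms(1)])
    fix x assume x: "x \<in> S"
    then have "g x \<in> T" using assms(3) by auto
    from has_derivative_compose[OF d[OF x]
        smooth_on_DERIV[OF Suc.prems(1) assms(2) this, unfolded has_field_derivative_def]]
    show "((\<lambda>x. f (g x)) has_derivative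
        (\<lambda>v. deriv f (g x) * frechet_derivative g (at x) v)) (at x)" .
  next
    show "Ck_on k (\<lambda>x. deriv f (g x) * frechet_derivative g (at x) v) S" for v
      using c Suc.prems(2) by (intro Ck_on_mult assms(1)) auto
  qed
qed

lemma Ck_on_minus:
  fixes f :: "'a::real_normed_vector \<Rightarrow> real"
  assumes "open S" "Ck_on k f S"
  shows "Ck_on k (\<lambda>x. - f x) S"
proof -
  have "Ck_on k (\<lambda>x. - 1 * f x) S"
    by (rule Ck_on_mult[OF assms(1) Ck_on_const[OF assms(1)] assms(2)])
  then show ?thesis by (simp only: mult_minus1)
qed

text \<open>The derivative is a polynomial in the function itself, so the induction on the order
  closes.\<close>

lemma smooth_on_inverse: "smooth_on (inverse :: real \<Rightarrow> real) (- {0})"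
  unfolding smooth_on_def
proof
  have o: "open (- {0::real})" by (rule open_Compl[OF closed_singleton])
  show "Ck_on k (inverse :: real \<Rightarrow> real) (- {0})" for k
  proof (induction k)
    case 0
    show ?case by (simp add: continuous_on_inverse[OF continuous_on_id])
  next
    case (Suc k)
    show ?case
    proof (rule Ck_on_SucI[OF o])
      show "(inverse has_derivative (\<lambda>v. - (inverse x * v * inverse x))) (at x)"
        if "x \<in> - {0}" for x :: real
        using that by (intro has_derivative_inverse') simp
      fix v :: real
      have "Ck_on k (\<lambda>x. inverse x * v) (- {0})"
        by (rule Ck_on_mult) (fact o Suc Ck_on_const[OF o])+
      then have "Ck_on k (\<lambda>x. inverse x * v * inverse x) (- {0})"
        by (rule Ck_on_mult[OF o _ Suc])
      then show "Ck_on k (\<lambda>x. - (inverse x * v * inverse x)) (- {0})"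
        by (rule Ck_on_minus[OF o])
    qed
  qed
qed

lemma Ck_on_divide:
  fixes f g :: "'a::real_normed_vector \<Rightarrow> real"
  assumes "open S" "Ck_on k f S" "Ck_on k g S" "\<And>x. x \<in> S \<Longrightarrow> g x \<noteq> 0"
  shows "Ck_on k (\<lambda>x. f x / g x) S"
  unfolding divide_inverse
proof (rule Ck_on_mult[OF assms(1,2)])
  show "Ck_on k (\<lambda>x. inverse (g x)) S"
  proof (rule Ck_on_compose_real[OF assms(1) _ _ smooth_on_inverse assms(3)])
    show "open (- {0::real})" by (rule open_Compl[OF closed_singleton])
    show "g ` S \<subseteq> - {0}" using assms(4) by auto
  qed
qed

text \<open>The image is open by invariance of domain. The derivative of the inverse
  \<open>g\<close> is 1 / f'(g y), which depends on y through \<open>g\<close> alone, so each order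
  of regularity of \<open>g\<close> yields the next.\<close>

lemma smooth_on_the_inv_into:
  fixes f :: "real \<Rightarrow> real"
  assumes "open S" "smooth_on f S" "inj_on f S" and nz: "\<And>x. x \<in> S \<Longrightarrow> deriv f x \<noteq> 0"
  shows "open (f ` S)" and "smooth_on (the_inv_into S f) (f ` S)"
proof -
  let ?g = "the_inv_into S f"
  have "Ck_on 0 f S" using assms(2) by (simp only: smooth_on_def)
  then have cont: "continuous_on S f" by simp
  show op: "open (f ` S)"
    using invariance_of_domain[OF cont assms(1,3)] .
  have g: "?g (f x) = x" if "x \<in> S" for x using the_inv_into_f_f[OF assms(3) that] .
  have d: "(?g has_derivative (\<lambda>v. inverse (deriv f (?g y)) * v)) (at y)" if "y \<in> f ` S" for y
  proof -
    from that obtain x where x: "x \<in> S" "y = f x" by blast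
    have "(f has_derivative (\<lambda>v. deriv f x * v)) (at x)"
      using smooth_on_DERIV[OF assms(2,1) x(1)] by (simp add: has_field_derivative_def)
    moreover have "(\<lambda>v. deriv f x * v) \<circ> (\<lambda>v. inverse (deriv f x) * v) = id"
      using nz[OF x(1)] by (auto simp: fun_eq_iff)
    ultimately show ?thesis
      using has_derivative_inverse_strong[OF assms(1) x(1) cont g] x(2) g[OF x(1)] by simp
  qed
  have img: "?g ` f ` S \<subseteq> S" using g by auto
  have "Ck_on k ?g (f ` S)" for k
  proof (induction k)
    case 0
    show ?case
      using has_derivative_continuous[OF d] by (simp add: continuous_at_imp_continuous_on)
  next
    case (Suc k)
    show ?case
    proof (rule Ck_on_SucI[OF op d])
      have d: "Ck_on k (\<lambda>y. deriv f (?g y)) (f ` S)"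
        by (rule Ck_on_compose_real[OF op assms(1) img smooth_on_deriv[OF assms(2,1)] Suc])
      have i: "Ck_on k (\<lambda>y. inverse (deriv f (?g y))) (f ` S)"
      proof (rule Ck_on_compose_real[OF op _ _ smooth_on_inverse d])
        show "open (- {0::real})" by (rule open_Compl[OF closed_singleton])
        show "(\<lambda>y. deriv f (?g y)) ` f ` S \<subseteq> - {0}" using nz g by auto
      qed
      show "Ck_on k (\<lambda>y. inverse (deriv f (?g y)) * v) (f ` S)" for v
        by (rule Ck_on_mult[OF op i Ck_on_const[OF op]])
    qed
  qed
  then show "smooth_on ?g (f ` S)" by (simp add: smooth_on_def)
qed

section \<open>Curvature of radial Hermitian metrics\<close>

text \<open>Caratheodory's criterion, with \<open>f\<close> as the difference quotient. A
  Christoffel component of the form e * f(e) can thus be differentiated at 0 without differentiating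
  \<open>f\<close>.\<close>

lemma has_real_derivative_ident_mult:
  fixes f :: "real \<Rightarrow> real"
  assumes "isCont f 0"
  shows "((\<lambda>x. x * f x) has_real_derivative f 0) (at 0)"
  unfolding CARAT_DERIV
proof (intro exI conjI allI)
  show "z * f z - 0 * f 0 = f z * (z - 0)" for z by simp
qed (use assms in simp_all)

text \<open>Write r for \<open>y \<bullet> y\<close>. The metric multiplies \<open>y\<close> by 1 +
  r A and \<open>J y\<close> by 1 + r B, relative to the Euclidean product; \<open>AB\<close> gives
  (1 + r A) (1 + r B) = 1.\<close>

locale radial_hermitian_metric =
  fixes J :: "'a::euclidean_space \<Rightarrow> 'a" and U :: "'a set"
    and A B A' B' :: "real \<Rightarrow> real" and h :: "'a \<Rightarrow> 'a \<Rightarrow> 'a \<Rightarrow> real"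
  assumes linear_J: "linear J" and JJ: "J (J x) = - x" and J_skew: "J x \<bullet> y = - (x \<bullet> J y)"
    and open_U: "open U"
    and DERIV_A: "y \<in> U \<Longrightarrow> (A has_real_derivative A' (y \<bullet> y)) (at (y \<bullet> y))"
    and DERIV_B: "y \<in> U \<Longrightarrow> (B has_real_derivative B' (y \<bullet> y)) (at (y \<bullet> y))"
    and differentiable_A': "y \<in> U \<Longrightarrow> A' differentiable at (y \<bullet> y)"
    and differentiable_B': "y \<in> U \<Longrightarrow> B' differentiable at (y \<bullet> y)"
    and AB: "y \<in> U \<Longrightarrow> A (y \<bullet> y) + B (y \<bullet> y) + (y \<bullet> y) * A (y \<bullet> y) * B (y \<bullet> y) = 0"
    and h_eq: "y \<in> U \<Longrightarrow> h y u v =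
      u \<bullet> v + A (y \<bullet> y) * (y \<bullet> u) * (y \<bullet> v) + B (y \<bullet> y) * (J y \<bullet> u) * (J y \<bullet> v)"
begin

section \<open>The Levi-Civita connection of the radial metric\<close>

lemma J_simps: "J (x + y) = J x + J y" "J (c *\<^sub>R x) = c *\<^sub>R J x" "J x \<bullet> x = 0" "x \<bullet> J x = 0"
  "J x \<bullet> J y = x \<bullet> y"
proof -
  show "J (x + y) = J x + J y" "J (c *\<^sub>R x) = c *\<^sub>R J x"
    using linear_J by (simp_all add: linear_add linear_scale)
  show "J x \<bullet> x = 0" using J_skew[of x x] by (simp add: inner_commute)
  then show "x \<bullet> J x = 0" by (simp add: inner_commute)
  show "J x \<bullet> J y = x \<bullet> y" using J_skew[of x "J y"] by (simp add: JJ)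
qed

lemma J_derivative [derivative_intros]:
  "(f has_derivative f') F \<Longrightarrow> ((\<lambda>x. J (f x)) has_derivative (\<lambda>v. J (f' v))) F"
  by (rule bounded_linear.has_derivative[OF linear_J[unfolded linear_conv_bounded_linear]])

text \<open>The vector whose Euclidean product with \<open>w\<close> is half the right-hand side of
  the Koszul formula.\<close>

definition koszul :: "'a \<Rightarrow> 'a \<Rightarrow> 'a \<Rightarrow> 'a" where
  "koszul y u v =
     (A' (y \<bullet> y) * (y \<bullet> u) * (y \<bullet> v) + A (y \<bullet> y) * (u \<bullet> v) - B' (y \<bullet> y) * (J y \<bullet> u) * (J y \<bullet> v)) *\<^sub>R y
   + (B' (y \<bullet> y) * ((y \<bullet> u) * (J y \<bullet> v) + (y \<bullet> v) * (J y \<bullet> u))) *\<^sub>R J y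
   + B (y \<bullet> y) *\<^sub>R ((J y \<bullet> v) *\<^sub>R J u + (J y \<bullet> u) *\<^sub>R J v)"

text \<open>By the relation between \<open>A\<close> and \<open>B\<close>, inverting the metric exchanges the two functions.\<close>

definition gamma :: "'a \<Rightarrow> 'a \<Rightarrow> 'a \<Rightarrow> 'a" where
  "gamma y u v = koszul y u v + (B (y \<bullet> y) * (y \<bullet> koszul y u v)) *\<^sub>R y
     + (A (y \<bullet> y) * (J y \<bullet> koszul y u v)) *\<^sub>R J y"

lemma frechet_derivative_h:
  assumes "y \<in> U"
  shows "frechet_derivative (\<lambda>y. h y v w) (at y) u =
     2 * A' (y \<bullet> y) * (y \<bullet> u) * (y \<bullet> v) * (y \<bullet> w)
     + A (y \<bullet> y) * ((u \<bullet> v) * (y \<bullet> w) + (y \<bullet> v) * (u \<bullet> w))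
     + 2 * B' (y \<bullet> y) * (y \<bullet> u) * (J y \<bullet> v) * (J y \<bullet> w)
     + B (y \<bullet> y) * ((J u \<bullet> v) * (J y \<bullet> w) + (J y \<bullet> v) * (J u \<bullet> w))"
proof -
  have s: "((\<lambda>y. y \<bullet> y) has_derivative (\<lambda>u. 2 * (y \<bullet> u))) (at y)"
    by (auto intro!: derivative_eq_intros simp: inner_commute)
  note a = has_derivative_compose[OF s DERIV_A[OF assms, unfolded has_field_derivative_def]]
  note b = has_derivative_compose[OF s DERIV_B[OF assms, unfolded has_field_derivative_def]]
  have "((\<lambda>y. v \<bullet> w + A (y \<bullet> y) * (y \<bullet> v) * (y \<bullet> w) + B (y \<bullet> y) * (J y \<bullet> v) * (J y \<bullet> w))
      has_derivative (\<lambda>u. 2 * A' (y \<bullet> y) * (y \<bullet> u) * (y \<bullet> v) * (y \<bullet> w)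
     + A (y \<bullet> y) * ((u \<bullet> v) * (y \<bullet> w) + (y \<bullet> v) * (u \<bullet> w))
     + 2 * B' (y \<bullet> y) * (y \<bullet> u) * (J y \<bullet> v) * (J y \<bullet> w)
     + B (y \<bullet> y) * ((J u \<bullet> v) * (J y \<bullet> w) + (J y \<bullet> v) * (J u \<bullet> w)))) (at y)"
    by (rule derivative_eq_intros a b refl | simp)+ (auto simp: algebra_simps)
  from has_derivative_transform_within_open[OF this open_U assms h_eq[symmetric]]
  show ?thesis by (simp add: frechet_derivative_at[symmetric])
qed

text \<open>Beside the Euclidean product with \<open>koszul\<close>, only multiples of the
  expression in \<open>AB\<close> remain.\<close>

lemma h_gamma:
  assumes "y \<in> U"
  shows "h y (gamma y u v) w = koszul y u v \<bullet> w"
proof -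
  define K where "K = koszul y u v"
  have "h y (gamma y u v) w = K \<bullet> w
     + (A (y \<bullet> y) + B (y \<bullet> y) + (y \<bullet> y) * A (y \<bullet> y) * B (y \<bullet> y)) * (y \<bullet> K) * (y \<bullet> w)
     + (A (y \<bullet> y) + B (y \<bullet> y) + (y \<bullet> y) * A (y \<bullet> y) * B (y \<bullet> y)) * (J y \<bullet> K) * (J y \<bullet> w)"
    unfolding h_eq[OF assms] gamma_def K_def[symmetric]
    by (simp add: inner_simps J_simps algebra_simps)
  then show ?thesis using AB[OF assms] by (simp add: K_def)
qed

lemma h_nondegenerate:
  assumes "y \<in> U" "\<And>w. h y X w = h y Y w"
  shows "X = Y"
proof -
  define K where "K = X - Y"
  \<comment> \<open>The inverse metric applied to \<open>K\<close>, built as in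
    \<open>gamma\<close>; pairing it with \<open>K\<close> by \<open>h\<close> gives the Euclidean
    square of \<open>K\<close>.\<close>
  define w where "w = K + (B (y \<bullet> y) * (y \<bullet> K)) *\<^sub>R y + (A (y \<bullet> y) * (J y \<bullet> K)) *\<^sub>R J y"
  have "h y X w - h y Y w = K \<bullet> K
     + (A (y \<bullet> y) + B (y \<bullet> y) + (y \<bullet> y) * A (y \<bullet> y) * B (y \<bullet> y)) * (y \<bullet> K)\<^sup>2
     + (A (y \<bullet> y) + B (y \<bullet> y) + (y \<bullet> y) * A (y \<bullet> y) * B (y \<bullet> y)) * (J y \<bullet> K)\<^sup>2"
    unfolding h_eq[OF assms(1)] w_def K_def
    by (simp add: inner_simps J_simps algebra_simps power2_eq_square inner_commute)
  then have "K \<bullet> K = 0" using AB[OF assms(1)] assms(2) by simp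
  then show ?thesis by (simp add: K_def)
qed

lemma christoffel_eq:
  assumes "y \<in> U"
  shows "christoffel h y u v = gamma y u v"
proof -
  let ?R = "\<lambda>w. frechet_derivative (\<lambda>y. h y v w) (at y) u
     + frechet_derivative (\<lambda>y. h y u w) (at y) v
     - frechet_derivative (\<lambda>y. h y u v) (at y) w"
  have eq: "2 * h y (gamma y u v) w = ?R w" for w
  proof -
    \<comment> \<open>These identities bring all products into one order, after which the two sides
      agree as polynomials.\<close>
    have J: "J v \<bullet> u = - (J u \<bullet> v)" "J w \<bullet> u = - (J u \<bullet> w)" "J w \<bullet> v = - (J v \<bullet> w)"
      using J_skew[of v u] J_skew[of w u] J_skew[of w v] by (simp_all add: inner_commute)
    have c: "v \<bullet> u = u \<bullet> v" "w \<bullet> u = u \<bullet> w" "w \<bullet> v = v \<bullet> w"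
      by (rule inner_commute)+
    show ?thesis
      unfolding h_gamma[OF assms] frechet_derivative_h[OF assms] koszul_def J c
      by (simp add: inner_simps algebra_simps)
  qed
  show ?thesis
    unfolding christoffel_def
  proof (rule the_equality)
    show "\<forall>w. 2 * h y (gamma y u v) w = ?R w" using eq by blast
    \<comment> \<open>The description operator needs uniqueness, which is nondegeneracy of
      \<open>h\<close>.\<close>
    show "G = gamma y u v" if "\<forall>w. 2 * h y G w = ?R w" for G
      using that eq by (intro h_nondegenerate[OF assms]) (metis mult_cancel_left zero_neq_numeral)
  qed
qed

section \<open>Derivatives of the Christoffel symbols\<close>

lemma gamma_differentiable:
  assumes "y \<in> U"
  shows "(\<lambda>y. gamma y u v) differentiable (at y)"
proof -
  have s: "(\<lambda>y. y \<bullet> y) differentiable (at y)" 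
    by (rule differentiableI[OF has_derivative_inner[OF has_derivative_ident has_derivative_ident]])
  have J: "J differentiable (at y)"
    using linear_J linear_conv_bounded_linear bounded_linear_imp_differentiable by blast
  have c: "(\<lambda>y. f (y \<bullet> y)) differentiable (at y)" if "f differentiable (at (y \<bullet> y))" 
    for f :: "real \<Rightarrow> real"
    using differentiable_compose[OF that s] .
  have "A differentiable (at (y \<bullet> y))" "B differentiable (at (y \<bullet> y))"
    using DERIV_A[OF assms] DERIV_B[OF assms] by (auto simp: real_differentiable_def)
  note d = this[THEN c] c[OF differentiable_A'[OF assms]] c[OF differentiable_B'[OF assms]] J s
  have l: "(\<lambda>y. y \<bullet> u) differentiable (at y)" "(\<lambda>y. J y \<bullet> u) differentiable (at y)" for u
    using J by (auto intro!: bounded_linear_imp_differentiable bounded_linear_inner_left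
        differentiable_compose[of "\<lambda>y. y \<bullet> u" J])
  have i: "(\<lambda>y. f y \<bullet> g y) differentiable (at y)"
    if "f differentiable (at y)" "g differentiable (at y)" for f g :: "'a \<Rightarrow> 'a"
    using that has_derivative_inner unfolding differentiable_def by blast
  show ?thesis
    unfolding gamma_def koszul_def by (intro derivative_intros d l i)
qed

text \<open>Since \<open>gamma\<close> is differentiable in its base point, a component of the
  Frechet derivative is a one-variable derivative along a straight line.\<close>

lemma frechet_derivative_christoffel:
  assumes "y \<in> U" "((\<lambda>e. gamma (y + e *\<^sub>R x) u v \<bullet> w) has_real_derivative d) (at 0)"
  shows "frechet_derivative (\<lambda>y. christoffel h y u v) (at y) x \<bullet> w = d"
proof -
  let ?D = "frechet_derivative (\<lambda>y. gamma y u v) (at y)"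
  have g: "((\<lambda>y. gamma y u v) has_derivative ?D) (at y)"
    using gamma_differentiable[OF assms(1)] frechet_derivative_works by blast
  then have "((\<lambda>y. christoffel h y u v) has_derivative ?D) (at y)"
    by (rule has_derivative_transform_within_open[OF _ open_U assms(1)]) (simp add: christoffel_eq)
  then have eq: "frechet_derivative (\<lambda>y. christoffel h y u v) (at y) = ?D"
    using frechet_derivative_at by metis
  have l: "((\<lambda>e. y + e *\<^sub>R x) has_derivative (\<lambda>e. e *\<^sub>R x)) (at 0)"
    by (auto intro!: derivative_eq_intros)
  have "((\<lambda>e. gamma (y + e *\<^sub>R x) u v \<bullet> w) has_derivative (\<lambda>e. ?D (e *\<^sub>R x) \<bullet> w)) (at 0)"
    using has_derivative_inner_left[OF has_derivative_compose[OF l, of "\<lambda>y. gamma y u v" ?D]] g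
    by simp
  from has_derivative_unique[OF this assms(2)[unfolded has_field_derivative_def]]
  have "?D (1 *\<^sub>R x) \<bullet> w = d * 1" by metis
  then show ?thesis using eq by simp
qed

text \<open>On a line leaving \<open>z\<close> orthogonally the squared norm is
  \<open>\<rho> + e\<^sup>2 * c\<close>, so the metric coefficients appear in this form.\<close>

lemma isCont_compose_quadratic:
  fixes f :: "real \<Rightarrow> real" and c \<rho> :: real
  assumes "isCont f \<rho>"
  shows "isCont (\<lambda>e. f (\<rho> + e\<^sup>2 * c)) 0"
proof (rule isCont_o2[of 0 "\<lambda>e. \<rho> + e\<^sup>2 * c" f])
  show "isCont (\<lambda>e. \<rho> + e\<^sup>2 * c) 0" by (intro continuous_intros)
  show "isCont f (\<rho> + 0\<^sup>2 * c)" using assms by simp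
qed

text \<open>At \<open>z\<close> the form \<open>h\<close> paired with \<open>u\<close> is Euclidean,
  so only the \<open>u\<close>-component of R(u, J u) J u counts. The two derivative terms, A c^2 -
  2 B c^2 + \<rho> A B c^2 and B c^2, differ by - 4 B c^2 because of \<open>AB\<close>.\<close>

proposition sectional_curvature_J:
  assumes "z \<in> U" "u \<noteq> 0" "z \<bullet> u = 0" "J z \<bullet> u = 0"
  shows "sectional_curvature h z u (J u) = - 4 * B (z \<bullet> z)"
proof -
  define c where "c = u \<bullet> u"
  define \<rho> where "\<rho> = z \<bullet> z"
  have c0: "c \<noteq> 0" using assms(2) by (simp add: c_def)
  have zJu: "z \<bullet> J u = 0" using J_skew[of z u] assms(4) by simp
  have zs: "u \<bullet> z = 0" "u \<bullet> J z = 0" "J u \<bullet> z = 0" "J u \<bullet> J z = 0" "J z \<bullet> J u = 0"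
    using assms(3,4) zJu by (simp_all add: inner_commute J_simps)
  note s = assms(3,4) zJu zs J_simps inner_simps JJ c_def[symmetric] \<rho>_def[symmetric]
  have conts: "isCont A \<rho>" "isCont B \<rho>" "isCont A' \<rho>" "isCont B' \<rho>"
    using DERIV_A[OF assms(1)] DERIV_B[OF assms(1)] differentiable_A'[OF assms(1)]
      differentiable_B'[OF assms(1)]
    by (auto simp: \<rho>_def intro: DERIV_isCont differentiable_imp_continuous_within)
  note conts = this[THEN isCont_compose_quadratic]
  \<comment> \<open>The cofactor of e in the component below. In it \<open>B'\<close> occurs only
    with e^2, so the value at 0 involves \<open>A\<close> and \<open>B\<close> alone.\<close>
  define \<psi> where "\<psi> e = (let r = \<rho> + e\<^sup>2 * c; k = A r * c - B' r * e\<^sup>2 * c\<^sup>2 in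
     k * c - 2 * B r * c\<^sup>2 + B r * c * (k * r - 2 * B r * e\<^sup>2 * c\<^sup>2))" for e
  have 1: "gamma (z + e *\<^sub>R u) (J u) (J u) \<bullet> u = e * \<psi> e" for e
  proof -
    have "(z + e *\<^sub>R u) \<bullet> (z + e *\<^sub>R u) = \<rho> + e\<^sup>2 * c"
      by (simp add: s power2_eq_square)
    then show ?thesis
      unfolding gamma_def koszul_def \<psi>_def Let_def
      by (simp add: s) (simp add: algebra_simps power2_eq_square)
  qed
  have "isCont \<psi> 0" unfolding \<psi>_def Let_def by (intro continuous_intros conts)
  from frechet_derivative_christoffel[OF assms(1), of u "J u" "J u" u,
      unfolded 1, OF has_real_derivative_ident_mult[OF this]]
  have D1: "frechet_derivative (\<lambda>y. christoffel h y (J u) (J u)) (at z) u \<bullet> u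
      = A \<rho> * c\<^sup>2 - 2 * B \<rho> * c\<^sup>2 + \<rho> * A \<rho> * B \<rho> * c\<^sup>2"
    by (simp add: \<psi>_def Let_def power2_eq_square)
  \<comment> \<open>The analogous cofactor along \<open>J u\<close>; again \<open>B'\<close> always
    carries e^2.\<close>
  define \<phi> where "\<phi> e = (let r = \<rho> + e\<^sup>2 * c in
     B' r * e\<^sup>2 * c ^ 3 + B r * c\<^sup>2
       + A r * c * (B' r * e\<^sup>2 * c\<^sup>2 * r + B r * e\<^sup>2 * c\<^sup>2))" for e
  have 2: "gamma (z + e *\<^sub>R J u) u (J u) \<bullet> u = e * \<phi> e" for e
  proof -
    have "(z + e *\<^sub>R J u) \<bullet> (z + e *\<^sub>R J u) = \<rho> + e\<^sup>2 * c"
      by (simp add: s power2_eq_square)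
    then show ?thesis
      unfolding gamma_def koszul_def \<phi>_def Let_def
      by (simp add: s) (simp add: algebra_simps power2_eq_square power3_eq_cube)
  qed
  have "isCont \<phi> 0" unfolding \<phi>_def Let_def by (intro continuous_intros conts)
  from frechet_derivative_christoffel[OF assms(1), of "J u" u "J u" u,
      unfolded 2, OF has_real_derivative_ident_mult[OF this]]
  have D2: "frechet_derivative (\<lambda>y. christoffel h y u (J u)) (at z) (J u) \<bullet> u = B \<rho> * c\<^sup>2"
    by (simp add: \<phi>_def Let_def)
  \<comment> \<open>The products of Christoffel symbols vanish at \<open>z\<close>: one inner symbol
    is radial and \<open>gamma z u\<close> kills radial vectors, while the other inner symbol is
    0.\<close>
  have g1: "gamma z (J u) (J u) = (A \<rho> * c * (1 + B \<rho> * \<rho>)) *\<^sub>R z"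
    unfolding gamma_def koszul_def by (simp add: s algebra_simps)
  have g2: "gamma z u (k *\<^sub>R z) = 0" for k
    unfolding gamma_def koszul_def by (simp add: s)
  have g3: "gamma z u (J u) = 0" "gamma z (J u) 0 = 0"
    unfolding gamma_def koszul_def by (simp_all add: s linear_0[OF linear_J])
  have "h z (riemann h z u (J u) (J u)) u = riemann h z u (J u) (J u) \<bullet> u"
    by (simp add: h_eq[OF assms(1)] s)
  also have "\<dots> = A \<rho> * c\<^sup>2 - 2 * B \<rho> * c\<^sup>2 + \<rho> * A \<rho> * B \<rho> * c\<^sup>2 - B \<rho> * c\<^sup>2"
    unfolding riemann_def
    by (simp add: inner_simps D1 D2 christoffel_eq[OF assms(1)] g1 g2 g3)
  also have "\<dots> = (A \<rho> + B \<rho> + \<rho> * A \<rho> * B \<rho>) * c\<^sup>2 - 4 * B \<rho> * c\<^sup>2"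
    by (simp add: algebra_simps)
  also have "\<dots> = - 4 * B \<rho> * c\<^sup>2"
    using AB[OF assms(1)] by (simp add: \<rho>_def)
  finally have "h z (riemann h z u (J u) (J u)) u = - 4 * B \<rho> * c\<^sup>2" .
  moreover have "h z u u = c" "h z (J u) (J u) = c" "h z u (J u) = 0"
    by (simp_all add: h_eq[OF assms(1)] s)
  ultimately show ?thesis
    using c0 by (simp add: sectional_curvature_def \<rho>_def power2_eq_square)
qed

end

section \<open>Rotational hypersurfaces of type II as graphs\<close>

lemma J0_linear: "linear (J0 :: complex ^ 'n::finite \<Rightarrow> complex ^ 'n)"
  by (rule linearI) (simp_all add: J0_def vec_eq_iff algebra_simps)

lemma J0_scaleR: "J0 (c *\<^sub>R x) = c *\<^sub>R J0 x"
  by (rule linear_scale[OF J0_linear])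

lemma J0_J0: "J0 (J0 x) = - x"
  by (simp add: J0_def vec_eq_iff flip: mult.assoc)

lemma J0_skew: "J0 x \<bullet> y = - (x \<bullet> J0 y)"
  by (simp add: J0_def inner_vec_def inner_complex_def flip: sum_negf)

text \<open>The real span of \<open>z\<close> and \<open>J0 z\<close> has dimension at most 2, the
  whole space at least 4. This is where n \<ge> 2 enters.\<close>

lemma exists_complex_orthogonal:
  fixes z :: "complex ^ 'n::finite"
  assumes "CARD('n) \<ge> 2"
  obtains u where "u \<noteq> 0" "z \<bullet> u = 0" "J0 z \<bullet> u = 0"
proof -
  have "dim {z, J0 z} \<le> card {z, J0 z}" by (intro dim_le_card') simp
  also have "\<dots> \<le> 2" by (simp add: card_insert_if)
  also have "2 < DIM(complex ^ 'n)" using assms by simp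
  finally obtain u where "u \<noteq> 0" "\<And>y. y \<in> span {z, J0 z} \<Longrightarrow> orthogonal u y"
    using orthogonal_to_subspace_exists by metis
  then show thesis
    by (intro that[of u]) (simp_all add: orthogonal_def inner_commute[of _ u] span_base)
qed

locale type_II_rotational =
  fixes I :: "real set" and t q :: "real \<Rightarrow> real" and N :: "'n::finite itself"
  assumes type_II: "type_II_hypersurface TYPE('n) I t q"
begin

section \<open>The profile in terms of the squared radius\<close>

lemma open_I: "open I" and interval_I: "is_interval I"
  and smooth_t: "smooth_on t I" and smooth_q: "smooth_on q I"
  using type_II by (auto simp: type_II_hypersurface_def)

lemma t_pos: "s \<in> I \<Longrightarrow> t s > 0"
  and natural: "s \<in> I \<Longrightarrow> (deriv t s)\<^sup>2 - (deriv q s)\<^sup>2 = 1"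
  and deriv_t_ge_1: "s \<in> I \<Longrightarrow> deriv t s \<ge> 1"
  using type_II by (auto simp: type_II_hypersurface_def)

lemmas DERIV_t = type_II_derivs(1)[OF type_II] and DERIV_q = type_II_derivs(2)[OF type_II]

text \<open>The squared radius is the natural variable, being the polynomial
  \<open>z \<bullet> z\<close> on the ambient complex space; \<open>\<tau>\<close> recovers the
  parameter from it.\<close>

definition T :: "real \<Rightarrow> real" where "T s = t s * t s"
definition \<tau> :: "real \<Rightarrow> real" where "\<tau> = the_inv_into I T"

lemma inj_T: "inj_on T I"
proof (rule inj_onI)
  fix x y assume "x \<in> I" "y \<in> I" "T x = T y"
  then have "t x = t y"
    using t_pos[of x] t_pos[of y] by (metis T_def less_eq_real_def power2_eq_square power2_eq_imp_eq)
  then show "x = y" using inj_onD[OF type_II_inj[OF type_II]] \<open>x \<in> I\<close> \<open>y \<in> I\<close> by blast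
qed

lemma \<tau>_T [simp]: "s \<in> I \<Longrightarrow> \<tau> (T s) = s"
  unfolding \<tau>_def by (rule the_inv_into_f_f[OF inj_T])

lemma T_pos: "s \<in> I \<Longrightarrow> T s > 0"
  by (simp add: T_def t_pos)

lemma DERIV_T: "s \<in> I \<Longrightarrow> (T has_real_derivative 2 * t s * deriv t s) (at s)"
  unfolding T_def using DERIV_mult[OF DERIV_t DERIV_t, of s] by (simp add: algebra_simps)

lemma smooth_T: "smooth_on T I"
proof -
  have "Ck_on k (\<lambda>s. t s * t s) I" for k
    using Ck_on_mult[OF open_I] smooth_t unfolding smooth_on_def by blast
  then show ?thesis unfolding smooth_on_def T_def by blast
qed

lemma deriv_T_nonzero: "s \<in> I \<Longrightarrow> deriv T s \<noteq> 0"
  using DERIV_imp_deriv[OF DERIV_T, of s] t_pos[of s] deriv_t_ge_1[of s] by simp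

lemma open_TI: "open (T ` I)" and smooth_\<tau>: "smooth_on \<tau> (T ` I)"
  unfolding \<tau>_def
  by (rule smooth_on_the_inv_into[OF open_I smooth_T inj_T deriv_T_nonzero]; assumption)+

lemma \<tau>_in: "\<tau> ` T ` I \<subseteq> I"
  by auto

lemma DERIV_\<tau>:
  assumes "s \<in> I"
  shows "(\<tau> has_real_derivative inverse (2 * t s * deriv t s)) (at (T s))"
proof -
  have d: "(\<tau> has_real_derivative deriv \<tau> (T s)) (at (T s))"
    using smooth_on_DERIV[OF smooth_\<tau> open_TI] assms by blast
  have "(T has_real_derivative 2 * t s * deriv t s) (at (\<tau> (T s)))"
    using DERIV_T assms by simp
  \<comment> \<open>The derivative exists already; its value comes from comparing two derivatives of
    \<open>T\<close> after \<open>\<tau>\<close>, which is the identity on an open set.\<close>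
  from DERIV_chain2[OF this d]
  have "((\<lambda>x. T (\<tau> x)) has_real_derivative 2 * t s * deriv t s * deriv \<tau> (T s)) (at (T s))" .
  moreover have "((\<lambda>x. T (\<tau> x)) has_real_derivative 1) (at (T s))"
    by (rule has_field_derivative_transform_within_open[OF DERIV_ident open_TI])
       (use assms in auto)
  ultimately have "2 * t s * deriv t s * deriv \<tau> (T s) = 1"
    by (rule DERIV_unique)
  then show ?thesis using d by (metis inverse_unique)
qed

text \<open>This is t' as a function of the squared radius r. With it the stretching factors become
  1 + r A = 1 / p and 1 + r B = p.\<close>

definition p :: "real \<Rightarrow> real" where "p r = deriv t (\<tau> r)"
definition A :: "real \<Rightarrow> real" where "A r = (1 - p r) / (p r * r)"
definition B :: "real \<Rightarrow> real" where "B r = (p r - 1) / r"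

lemma p_T: "s \<in> I \<Longrightarrow> p (T s) = deriv t s"
  by (simp add: p_def)

lemma smooth_A: "smooth_on A (T ` I)" and smooth_B: "smooth_on B (T ` I)"
proof -
  have p: "Ck_on k p (T ` I)" for k
    unfolding p_def
    by (rule Ck_on_compose_real[OF open_TI open_I \<tau>_in smooth_on_deriv[OF smooth_t open_I]])
       (use smooth_\<tau> in \<open>simp only: smooth_on_def\<close>)
  have id: "Ck_on k (\<lambda>r. r) (T ` I)" for k
    by (rule Ck_on_linear[OF bounded_linear_ident open_TI])
  have c: "Ck_on k (\<lambda>r. c) (T ` I)" for k and c :: real
    by (rule Ck_on_const[OF open_TI])
  have p0: "p r \<noteq> 0" "r \<noteq> 0" if "r \<in> T ` I" for r
    using that p_T deriv_t_ge_1 T_pos by force+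
  have "Ck_on k (\<lambda>r. 1 + - p r) (T ` I)" "Ck_on k (\<lambda>r. p r + -1) (T ` I)"
    "Ck_on k (\<lambda>r. p r * r) (T ` I)" for k
    by (rule Ck_on_add Ck_on_mult Ck_on_minus p id c open_TI)+
  note num = this
  have "Ck_on k (\<lambda>r. (1 + - p r) / (p r * r)) (T ` I)" for k
    by (rule Ck_on_divide[OF open_TI num(1,3)]) (use p0 in simp)
  moreover have "Ck_on k (\<lambda>r. (p r + -1) / r) (T ` I)" for k
    by (rule Ck_on_divide[OF open_TI num(2) id]) (use p0 in simp)
  ultimately show "smooth_on A (T ` I)" "smooth_on B (T ` I)"
    unfolding smooth_on_def A_def B_def by simp_all
qed

section \<open>The graph chart and its pullback metric\<close>

definition dom :: "(complex ^ 'n) set" where "dom = {z. z \<bullet> z \<in> T ` I}"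
text \<open>As t' \<ge> 1, the meridian is a graph over t, and this single chart covers the whole
  hypersurface.\<close>

definition chart :: "complex ^ 'n \<Rightarrow> 'n ambient" where "chart z = (z, q (\<tau> (z \<bullet> z)))"

lemma open_dom: "open dom"
proof -
  have "continuous_on UNIV (\<lambda>z :: complex ^ 'n. z \<bullet> z)" by (intro continuous_intros)
  from open_vimage[OF open_TI this] show ?thesis by (simp add: dom_def vimage_def)
qed

lemma dom_polar:
  assumes "z \<in> dom"
  obtains s n where "s \<in> I" "norm n = 1" "z = t s *\<^sub>R n" "z \<bullet> z = T s"
proof -
  obtain s where s: "s \<in> I" "z \<bullet> z = T s" using assms by (auto simp: dom_def)
  have "(norm z)\<^sup>2 = (t s)\<^sup>2" using s(2) by (simp add: T_def power2_norm_eq_inner flip: power2_eq_square)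
  then have "norm z = t s" using t_pos[OF s(1)] by (simp add: power2_eq_iff_nonneg)
  then show thesis using that[of s "z /\<^sub>R t s"] s t_pos[OF s(1)] by simp
qed

lemma polar_in_dom:
  assumes "s \<in> I" "norm n = 1"
  shows "t s *\<^sub>R n \<in> dom" "(t s *\<^sub>R n) \<bullet> (t s *\<^sub>R n) = T s" "chart (t s *\<^sub>R n) = rot_point t q s n"
proof -
  show T: "(t s *\<^sub>R n) \<bullet> (t s *\<^sub>R n) = T s" using assms(2) by (simp add: T_def dot_square_norm power2_eq_square)
  then show "t s *\<^sub>R n \<in> dom" using assms(1) by (simp add: dom_def)
  show "chart (t s *\<^sub>R n) = rot_point t q s n"
    unfolding chart_def T using assms(1) by (simp add: rot_point_def)
qed

lemma chart_image: "chart ` dom = rot_hypersurface I t q"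
proof
  show "chart ` dom \<subseteq> rot_hypersurface I t q"
  proof
    fix Z assume "Z \<in> chart ` dom"
    then obtain z where z: "z \<in> dom" "Z = chart z" by blast
    from z(1) obtain s n where "s \<in> I" "norm n = 1" "z = t s *\<^sub>R n" by (rule dom_polar)
    then show "Z \<in> rot_hypersurface I t q"
      using polar_in_dom(3) z(2) by (auto simp: rot_hypersurface_def)
  qed
  show "rot_hypersurface I t q \<subseteq> chart ` dom"
  proof
    fix Z :: "'n ambient" assume "Z \<in> rot_hypersurface I t q"
    then obtain s n where "s \<in> I" "norm n = 1" "Z = rot_point t q s n"
      by (auto simp: rot_hypersurface_def)
    then show "Z \<in> chart ` dom" using polar_in_dom[of s n] by (metis imageI)
  qed
qed

text \<open>The factor 2 t from \<open>z \<bullet> z\<close> cancels against 1 / (2 t t') from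
  \<open>\<tau>\<close>, leaving the slope dq/dt = q' / t' in the radial direction.\<close>

lemma frechet_derivative_chart:
  assumes "s \<in> I" "norm n = 1"
  shows "frechet_derivative chart (at (t s *\<^sub>R n)) u = (u, deriv q s / deriv t s * (n \<bullet> u))"
proof -
  let ?z = "t s *\<^sub>R n"
  note z = polar_in_dom(2)[OF assms]
  have "((\<lambda>z. z \<bullet> z) has_derivative (\<lambda>u. 2 * (?z \<bullet> u))) (at ?z)"
    by (auto intro!: derivative_eq_intros simp: inner_commute)
  moreover have "(\<tau> has_derivative (*) (inverse (2 * t s * deriv t s))) (at (?z \<bullet> ?z))"
    using DERIV_\<tau>[OF assms(1)] z by (simp add: has_field_derivative_def)
  ultimately have "((\<lambda>z. \<tau> (z \<bullet> z)) has_derivative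
      (\<lambda>u. inverse (2 * t s * deriv t s) * (2 * (?z \<bullet> u)))) (at ?z)"
    by (rule has_derivative_compose)
  moreover have "(q has_derivative (*) (deriv q s)) (at (\<tau> (?z \<bullet> ?z)))"
    using DERIV_q[OF assms(1)] z assms(1) by (simp add: has_field_derivative_def)
  ultimately have "((\<lambda>z. q (\<tau> (z \<bullet> z))) has_derivative
      (\<lambda>u. deriv q s * (inverse (2 * t s * deriv t s) * (2 * (?z \<bullet> u))))) (at ?z)"
    by (rule has_derivative_compose)
  then have "(chart has_derivative
      (\<lambda>u. (u, deriv q s * (inverse (2 * t s * deriv t s) * (2 * (?z \<bullet> u)))))) (at ?z)"
    unfolding chart_def by (rule has_derivative_Pair[OF has_derivative_ident])
  from frechet_derivative_at[OF this, symmetric] show ?thesis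
    using t_pos[OF assms(1)] by (simp add: field_simps)
qed

text \<open>Projection to the first component inverts a graph, and the derivative is injective
  because its first component is the identity. The image is everything, hence relatively
  open.\<close>

lemma local_parametrization_chart: "local_parametrization chart dom (rot_hypersurface I t q)"
  unfolding local_parametrization_def chart_image
proof (intro conjI ballI)
  show smooth: "smooth_on chart dom"
    unfolding smooth_on_def chart_def
  proof (intro allI Ck_on_Pair[OF open_dom])
    fix k
    have id: "Ck_on k (\<lambda>z. z) dom" by (rule Ck_on_linear[OF bounded_linear_ident open_dom])
    then show "Ck_on k (\<lambda>z. z) dom" .
    have "Ck_on k (\<lambda>z. \<tau> (z \<bullet> z)) dom"
      by (rule Ck_on_compose_real[OF open_dom open_TI _ smooth_\<tau> Ck_on_inner[OF open_dom id id]])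
         (auto simp: dom_def)
    moreover have "(\<lambda>z. \<tau> (z \<bullet> z)) ` dom \<subseteq> I" by (auto simp: dom_def)
    ultimately show "Ck_on k (\<lambda>z. q (\<tau> (z \<bullet> z))) dom"
      using Ck_on_compose_real[OF open_dom open_I _ smooth_q] by blast
  qed
  have "Ck_on 0 chart dom" using smooth by (simp only: smooth_on_def)
  moreover have "fst (chart z) = z" for z by (simp add: chart_def)
  moreover have "continuous_on (chart ` dom) fst" by (intro continuous_intros)
  ultimately have "homeomorphism dom (rot_hypersurface I t q) chart fst"
    unfolding homeomorphism_def chart_image[symmetric] by (auto simp: image_image)
  then show "\<exists>G. homeomorphism dom (rot_hypersurface I t q) chart G" by blast
  fix z assume "z \<in> dom"
  then obtain s n where sn: "s \<in> I" "norm n = 1" "z = t s *\<^sub>R n" by (rule dom_polar)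
  show "inj (frechet_derivative chart (at z))"
    by (rule injI) (simp add: sn(3) frechet_derivative_chart[OF sn(1,2)])
qed (auto simp: open_dom)

text \<open>By t'^2 - q'^2 = 1, \<open>eta\<close> of the lift of \<open>u\<close> is
  \<open>n \<bullet> u\<close> divided by t'. The radial coefficient is therefore 1 - q'^2 / t'^2 +
  (t' - 1) / t'^2 = 1 / t', and the one along \<open>J0 n\<close> is 1 + (t' - 1) = t'.\<close>

lemma pullback_kahler_metric:
  assumes "z \<in> dom"
  shows "pullback chart (kahler_metric I t q) z u v =
    u \<bullet> v + A (z \<bullet> z) * (z \<bullet> u) * (z \<bullet> v) + B (z \<bullet> z) * (J0 z \<bullet> u) * (J0 z \<bullet> v)"
proof -
  obtain s n where sn: "s \<in> I" "norm n = 1" "z = t s *\<^sub>R n" "z \<bullet> z = T s"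
    using assms by (rule dom_polar)
  define P where "P = deriv t s"
  define Q where "Q = deriv q s"
  have P: "P \<ge> 1" "Q\<^sup>2 = P\<^sup>2 - 1"
    using deriv_t_ge_1[OF sn(1)] natural[OF sn(1)] by (auto simp: P_def Q_def)
  have AB: "A (z \<bullet> z) = (1 - P) / (P * (t s)\<^sup>2)" "B (z \<bullet> z) = (P - 1) / (t s)\<^sup>2"
    unfolding A_def B_def sn(4) p_T[OF sn(1)] P_def by (simp_all add: T_def power2_eq_square)
  have Jz: "J0 z = t s *\<^sub>R J0 n" unfolding sn(3) by (rule J0_scaleR)
  have eta: "eta I t q (chart z) (u, Q / P * (n \<bullet> u)) = (n \<bullet> u) / P" for u
  proof -
    have "eta I t q (chart z) (u, Q / P * (n \<bullet> u)) = (P - Q\<^sup>2 / P) * (n \<bullet> u)"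
      unfolding eta_def sn(3) polar_in_dom(3)[OF sn(1,2)] xi_point[OF type_II sn(1,2)] P_def Q_def
      by (simp add: mink_def power2_eq_square algebra_simps)
    also have "P - Q\<^sup>2 / P = 1 / P" using P by (simp add: field_simps power2_eq_square)
    finally show ?thesis by simp
  qed
  have eta_tilde: "eta_tilde I t q (chart z) (u, r) = J0 n \<bullet> u" for u r
    unfolding eta_tilde_def xi_tilde_def sn(3) polar_in_dom(3)[OF sn(1,2)]
      rot_coords_point[OF type_II sn(1,2)] by (simp add: mink_def)
  have "pullback chart (kahler_metric I t q) z u v =
      u \<bullet> v - Q\<^sup>2 / P\<^sup>2 * (n \<bullet> u) * (n \<bullet> v)
      + (P - 1) * ((n \<bullet> u) * (n \<bullet> v) / P\<^sup>2 + (J0 n \<bullet> u) * (J0 n \<bullet> v))"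
    unfolding pullback_def kahler_metric_def sn(3) frechet_derivative_chart[OF sn(1,2)]
      eta[unfolded sn(3) P_def Q_def] eta_tilde[unfolded sn(3)]
    unfolding polar_in_dom(3)[OF sn(1,2)] rot_coords_point[OF type_II sn(1,2)]
    by (simp add: mink_def P_def Q_def power2_eq_square)
  also have "\<dots> = u \<bullet> v + (1 - P) / P * (n \<bullet> u) * (n \<bullet> v) + (P - 1) * (J0 n \<bullet> u) * (J0 n \<bullet> v)"
    unfolding P(2) using P(1) by (simp add: field_simps power2_eq_square)
  also have "\<dots> = u \<bullet> v + A (z \<bullet> z) * (z \<bullet> u) * (z \<bullet> v) + B (z \<bullet> z) * (J0 z \<bullet> u) * (J0 z \<bullet> v)"
    unfolding AB Jz using t_pos[OF sn(1)] P by (simp add: sn(3) power2_eq_square)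
  finally show ?thesis .
qed

lemma radial_hermitian:
  "radial_hermitian_metric J0 dom A B (deriv A) (deriv B) (pullback chart (kahler_metric I t q))"
proof (rule radial_hermitian_metric.intro)
  fix z assume z: "z \<in> dom"
  then have zT: "z \<bullet> z \<in> T ` I" by (simp add: dom_def)
  show "(A has_real_derivative deriv A (z \<bullet> z)) (at (z \<bullet> z))"
    "(B has_real_derivative deriv B (z \<bullet> z)) (at (z \<bullet> z))"
    using smooth_on_DERIV[OF _ open_TI zT] smooth_A smooth_B by blast+
  show "deriv A differentiable at (z \<bullet> z)" "deriv B differentiable at (z \<bullet> z)"
    using smooth_on_DERIV[OF smooth_on_deriv[OF _ open_TI] open_TI zT] smooth_A smooth_B
      real_differentiable_def by blast+
  obtain s where "s \<in> I" "z \<bullet> z = T s" using zT by blast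
  \<comment> \<open>Equivalent, up to the nonzero factor r = \<open>z \<bullet> z\<close>, to (1 + r
    A) (1 + r B) = (1 / p) p = 1.\<close>
  then show "A (z \<bullet> z) + B (z \<bullet> z) + (z \<bullet> z) * A (z \<bullet> z) * B (z \<bullet> z) = 0"
    using p_T[of s] deriv_t_ge_1[of s] T_pos[of s]
    by (simp add: A_def B_def field_simps)
qed (fact J0_linear J0_J0 J0_skew open_dom pullback_kahler_metric)+

text \<open>One plane per point suffices: equating its curvature - 4 (t' - 1) / t^2 with
  \<open>a\<close> determines t'.\<close>

proposition deriv_t_eq:
  assumes "CARD('n) \<ge> 2"
    and "constant_holomorphic_curvature (rot_hypersurface I t q :: 'n ambient set)
           (kahler_metric I t q) (Jstruct I t q) a"
    and s: "s \<in> I"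
  shows "deriv t s = 1 - a * (t s)\<^sup>2 / 4"
proof -
  obtain n :: "complex ^ 'n" where n: "norm n = 1" using vector_choose_size[of 1] zero_le_one by blast
  let ?z = "t s *\<^sub>R n"
  obtain u where u: "u \<noteq> 0" "?z \<bullet> u = 0" "J0 ?z \<bullet> u = 0"
    by (rule exists_complex_orthogonal[OF assms(1)])
  have nu: "n \<bullet> u = 0" "J0 n \<bullet> u = 0"
    using u(2) u(3)[unfolded J0_scaleR] t_pos[OF s] by auto
  then have "n \<bullet> J0 u = 0" using J0_skew[of n u] by simp
  \<comment> \<open>The lifts of \<open>u\<close> and \<open>J0 u\<close> have no e-component, and
    the lift of \<open>u\<close> lies in the distribution D, where the complex structure acts as
    \<open>J0\<close>.\<close>
  then have "frechet_derivative chart (at ?z) (J0 u) =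
      Jstruct I t q (chart ?z) (frechet_derivative chart (at ?z) u)"
    unfolding frechet_derivative_chart[OF s n] polar_in_dom(3)[OF s n] Jstruct_def eta_def
      eta_tilde_def xi_point[OF type_II s n] xi_tilde_def rot_coords_point[OF type_II s n]
    using nu by (simp add: mink_def Let_def)
  then have "sectional_curvature (pullback chart (kahler_metric I t q)) ?z u (J0 u) = a"
    using assms(2) local_parametrization_chart polar_in_dom(1)[OF s n] u(1)
    unfolding constant_holomorphic_curvature_def by blast
  moreover have "sectional_curvature (pullback chart (kahler_metric I t q)) ?z u (J0 u) =
      - 4 * B (?z \<bullet> ?z)"
    by (rule radial_hermitian_metric.sectional_curvature_J[OF radial_hermitian])
       (fact polar_in_dom(1)[OF s n] u)+
  ultimately have "a = - 4 * B (T s)" using polar_in_dom(2)[OF s n] by simp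
  then show ?thesis
    using t_pos[OF s] unfolding B_def p_T[OF s]
    by (simp add: T_def field_simps power2_eq_square)
qed

end

section \<open>Integration of the meridian\<close>

text \<open>By partial fractions the logarithm contributes 4 / (u^2 - 4) times u', and 1 + 4 / (u^2
  - 4) = u^2 / (u^2 - 4). The bound u > 2 keeps its argument positive.\<close>

lemma DERIV_meridian:
  fixes u :: "real \<Rightarrow> real"
  assumes "(u has_real_derivative u') (at s)" "u s > 2"
  shows "((\<lambda>s. u s + ln ((u s - 2) / (u s + 2))) has_real_derivative
    u' * (u s)\<^sup>2 / ((u s)\<^sup>2 - 4)) (at s)"
proof -
  have "((\<lambda>s. u s + ln ((u s - 2) / (u s + 2))) has_real_derivative
      u' + (u' * (u s + 2) - (u s - 2) * u') / ((u s + 2) * (u s + 2)) / ((u s - 2) / (u s + 2))) (at s)"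
    using assms by (auto intro!: derivative_eq_intros)
  also have "u' + (u' * (u s + 2) - (u s - 2) * u') / ((u s + 2) * (u s + 2)) / ((u s - 2) / (u s + 2))
      = u' + 4 * u' / ((u s + 2) * (u s - 2))"
    using assms(2) by (simp add: divide_simps) (simp add: algebra_simps)
  also have "(u s + 2) * (u s - 2) = (u s)\<^sup>2 - 4"
    by (simp add: algebra_simps power2_eq_square)
  also have "u' + 4 * u' / ((u s)\<^sup>2 - 4) = u' * (u s)\<^sup>2 / ((u s)\<^sup>2 - 4)"
  proof -
    have "(u s)\<^sup>2 > 2\<^sup>2" using assms(2) by (intro power_strict_mono) auto
    then show ?thesis by (simp add: field_simps)
  qed
  finally show ?thesis .
qed

text \<open>A connected image that contains a negative value and misses 0 contains no positive
  value.\<close>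

lemma nonzero_constant_sign:
  fixes f :: "real \<Rightarrow> real"
  assumes "connected I" "continuous_on I f" "\<And>s. s \<in> I \<Longrightarrow> f s \<noteq> 0"
  obtains \<epsilon> where "\<epsilon> \<in> {1, -1 :: real}" "\<And>s. s \<in> I \<Longrightarrow> f s = \<epsilon> * \<bar>f s\<bar>"
proof (cases "\<exists>s\<in>I. f s < 0")
  case True
  then obtain x where x: "x \<in> I" "f x < 0" by blast
  have "f s < 0" if s: "s \<in> I" for s
  proof (rule ccontr)
    assume "\<not> f s < 0"
    then have "0 \<in> f ` I"
      using connectedD_interval[OF connected_continuous_image[OF assms(2,1)], of "f x" "f s" 0] x s
      by simp
    then show False using assms(3) by auto
  qed
  then show thesis by (intro that[of "-1"]) force+
next
  case False
  then show thesis by (intro that[of 1]) force+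
qed

theorem proposition6p7:
  fixes I :: "real set" and t q :: "real \<Rightarrow> real" and a :: real
  assumes "CARD('n::finite) \<ge> 2"
    and "type_II_hypersurface TYPE('n) I t q"
    and "a < 0"
    and "constant_holomorphic_curvature (rot_hypersurface I t q :: 'n ambient set)
           (kahler_metric I t q) (Jstruct I t q) a"
  shows "\<exists>q0 \<epsilon>. \<epsilon> \<in> {1, -1} \<and>
           (\<forall>s\<in>I. q s = \<epsilon> * (1 / sqrt (-a))
              * (sqrt (8 - a * (t s)\<^sup>2)
                 + ln ((sqrt (8 - a * (t s)\<^sup>2) - 2) / (sqrt (8 - a * (t s)\<^sup>2) + 2)))
              + q0)"
proof -
  interpret type_II_rotational I t q "TYPE('n)"
    by (unfold_locales) (rule assms(2))
  define k where "k = sqrt (-a)"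
  \<comment> \<open>Chosen so that u^2 - 4 = 4 t' on \<open>I\<close>.\<close>
  define u where "u s = sqrt (8 - a * (t s)\<^sup>2)" for s
  define G where "G s = u s + ln ((u s - 2) / (u s + 2))" for s
  have k: "k > 0" "a = - k\<^sup>2" using assms(3) by (simp_all add: k_def)
  have slope: "deriv t s = 1 - a * (t s)\<^sup>2 / 4" if "s \<in> I" for s
    using deriv_t_eq[OF assms(1,4) that] .
  have u2: "(u s)\<^sup>2 = 8 - a * (t s)\<^sup>2" and u_gt: "u s > 2" for s
  proof -
    have "a * (t s)\<^sup>2 \<le> 0" using assms(3) by (simp add: mult_nonpos_nonneg)
    then show "(u s)\<^sup>2 = 8 - a * (t s)\<^sup>2" "u s > 2"
      by (simp_all add: u_def real_less_rsqrt)
  qed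
  \<comment> \<open>Here t'^2 - 1 = (t' - 1) (t' + 1) = - a t^2 (8 - a t^2) / 16, a perfect square
    in terms of \<open>k\<close>, t and \<open>u\<close>.\<close>
  have abs_q: "\<bar>deriv q s\<bar> = k * t s * u s / 4" if s: "s \<in> I" for s
  proof (rule power2_eq_imp_eq)
    have "(deriv q s)\<^sup>2 = (1 - a * (t s)\<^sup>2 / 4)\<^sup>2 - 1" using natural[OF s] slope[OF s] by simp
    also have "\<dots> = k\<^sup>2 * (t s)\<^sup>2 * (8 - a * (t s)\<^sup>2) / 16"
      by (simp add: k(2) power2_eq_square field_simps)
    also have "\<dots> = (k * t s * u s / 4)\<^sup>2"
      by (simp add: power_mult_distrib power_divide u2)
    finally show "\<bar>deriv q s\<bar>\<^sup>2 = (k * t s * u s / 4)\<^sup>2" by simp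
  qed (use k(1) t_pos[OF s] u_gt[of s] in auto)
  \<comment> \<open>Strict negativity of \<open>a\<close> enters through k > 0. As q' never
    vanishes, one sign serves the whole interval.\<close>
  have "deriv q s \<noteq> 0" if "s \<in> I" for s
  proof -
    have "0 < k * t s * u s / 4" using k(1) t_pos[OF that] u_gt[of s] by simp
    then show ?thesis using abs_q[OF that] by simp
  qed
  moreover have "Ck_on 0 (deriv q) I"
    using smooth_on_deriv[OF smooth_q open_I] by (simp only: smooth_on_def)
  moreover have "connected I" using interval_I by (rule is_interval_connected)
  ultimately obtain \<epsilon> where \<epsilon>: "\<epsilon> \<in> {1, -1 :: real}"
    and sign: "\<And>s. s \<in> I \<Longrightarrow> deriv q s = \<epsilon> * \<bar>deriv q s\<bar>"
    using nonzero_constant_sign[of I "deriv q"] by (metis Ck_on.simps(1))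
  \<comment> \<open>Since u' = - a t t' / u and u^2 - 4 = 4 t', the factor t' cancels and G' = k^2 t
    u / 4, which is k times the absolute value of q'.\<close>
  have "((\<lambda>s. q s - \<epsilon> / k * G s) has_real_derivative 0) (at s)" if s: "s \<in> I" for s
  proof -
    have "8 - a * (t s)\<^sup>2 > 0" using u2[of s] u_gt[of s] by (metis less_trans zero_less_numeral zero_less_power)
    then have "(u has_real_derivative (- (a * (2 * t s * deriv t s))) / (2 * u s)) (at s)"
      unfolding u_def using DERIV_t[OF s]
      by (auto intro!: derivative_eq_intros simp: field_simps)
    note DERIV_meridian[OF this u_gt, folded G_def]
    also have "(- (a * (2 * t s * deriv t s))) / (2 * u s) * (u s)\<^sup>2 / ((u s)\<^sup>2 - 4)
        = - a * t s * u s * deriv t s / ((u s)\<^sup>2 - 4)"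
      using u_gt[of s] by (simp add: power2_eq_square)
    also have "\<dots> = k\<^sup>2 * t s * u s / 4"
    proof -
      have "(u s)\<^sup>2 - 4 = 4 * deriv t s" using u2 slope[OF s] by simp
      then show ?thesis using deriv_t_ge_1[OF s] k(2) by simp
    qed
    finally have "(G has_real_derivative k\<^sup>2 * t s * u s / 4) (at s)" .
    from DERIV_diff[OF DERIV_q[OF s] DERIV_cmult[OF this, of "\<epsilon> / k"]]
    have "((\<lambda>s. q s - \<epsilon> / k * G s) has_real_derivative
        \<epsilon> * (k * t s * u s / 4) - \<epsilon> / k * (k\<^sup>2 * t s * u s / 4)) (at s)"
      using sign[OF s] unfolding abs_q[OF s] by (simp only:)
    then show ?thesis using k(1) by (simp add: power2_eq_square)
  qed
  \<comment> \<open>A single constant works because the interval is convex.\<close>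
  then have "\<exists>q0. \<forall>s\<in>I. q s - \<epsilon> / k * G s = q0"
    by (rule has_field_derivative_zero_constant[OF is_interval_convex[OF interval_I]
          has_field_derivative_at_within])
  then obtain q0 where q0: "\<And>s. s \<in> I \<Longrightarrow> q s - \<epsilon> / k * G s = q0" by blast
  then have "q s = \<epsilon> * (1 / k) * G s + q0" if "s \<in> I" for s
    using q0[OF that] by simp
  then show ?thesis
    using \<epsilon> unfolding G_def u_def k_def by blast
qed

end
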